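(* Let $A$ be a real $m\times k$ matrix and $B$ a real $n\times k$ matrix with $m\leq n$. Then $\mathcal{Z}(A)$ and $\mathcal{Z}(B)$ are congruent if and only if $(A')^TA'=B^TB$ where $A'=A\Sigma J$ for some $k\times k$ permutation matrix $\Sigma$ and some $k\times k$ diagonal matrix $J$ with $\pm1$'s on the diagonal; equivalently, $\mathcal{Z}(A)$ and $\mathcal{Z}(B)$ are congruent if and only if there exist an $n\times m$ matrix $Q$ with orthonormal columns, a $k\times k$ permutation matrix $\Sigma$ and a $k\times k$ diagonal matrix $J$ with $\pm 1$'s on the diagonal such that $B=QA\Sigma J$.
   Context: For a real matrix $A=[\boldsymbol{a}_1,\ldots,\boldsymbol{a}_k]$ with columns $\boldsymbol{a}_i\in\mathbb{R}^m$, the zonotope generated by the columns of $A$ is $\mathcal{Z}(A)=\{\sum_i t_i\boldsymbol{a}_i\mid 0\leq t_i\leq 1\}\subset\mathbb{R}^m$. Two zonotopes, possibly lying in Euclidean spaces of different dimensions, are congruent if there is a distance-preserving map from one of the Euclidean spaces to the other carrying one zonotope onto the other (the zonotopes need not be attached to the origin at corresponding vertices).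
   Formalization: The implication from congruence to the matrix conditions is proved only when neither A nor B has two distinct nonzero parallel columns; without this it fails, e.g. A=[1 1], B=[0 2] both generate [0,2]. The other implications hold for all A and B. *)

theory Defs
  imports "HOL-Analysis.Analysis"
begin

text \<open>A matrix of type \<^typ>\<open>real ^ 'k ^ 'm\<close> has rows indexed by \<open>'m\<close> and columns indexed by
  \<open>'k\<close>, so it is an $m \times k$ matrix and its columns are vectors of type \<^typ>\<open>real ^ 'm\<close>.\<close>

definition zonotope :: "real ^ 'k ^ 'm \<Rightarrow> (real ^ 'm) set" where
  "zonotope A = {\<Sum>i\<in>UNIV. t i *\<^sub>R column i A | t. \<forall>i. 0 \<le> t i \<and> t i \<le> (1::real)}"

text \<open>The distance-preserving map is defined on a whole ambient space and need not be linear,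
  surjective or origin-preserving; it may go in either direction. (The name avoids the
  unrelated constant \<open>congruent\<close> of the library.)\<close>

definition congruent_sets :: "'a::metric_space set \<Rightarrow> 'b::metric_space set \<Rightarrow> bool" where
  "congruent_sets S T \<longleftrightarrow>
     (\<exists>f::'a \<Rightarrow> 'b. (\<forall>x y. dist (f x) (f y) = dist x y) \<and> f ` S = T) \<or>
     (\<exists>g::'b \<Rightarrow> 'a. (\<forall>x y. dist (g x) (g y) = dist x y) \<and> g ` T = S)"

definition permutation_matrix :: "real ^ 'k ^ 'k \<Rightarrow> bool" where
  "permutation_matrix P \<longleftrightarrow>
     (\<exists>\<pi>. \<pi> permutes UNIV \<and> P = (\<chi> i j. if i = \<pi> j then 1 else 0))"

definition sign_matrix :: "real ^ 'k ^ 'k \<Rightarrow> bool" where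
  "sign_matrix J \<longleftrightarrow>
     (\<forall>i j. i \<noteq> j \<longrightarrow> J $ i $ j = 0) \<and> (\<forall>i. J $ i $ i = 1 \<or> J $ i $ i = - 1)"

definition orthonormal_columns :: "real ^ 'm ^ 'n \<Rightarrow> bool" where
  "orthonormal_columns Q \<longleftrightarrow>
     (\<forall>i. norm (column i Q) = 1) \<and>
     (\<forall>i j. i \<noteq> j \<longrightarrow> orthogonal (column i Q) (column j Q))"

text \<open>No two distinct columns are nonzero and parallel; zero columns are allowed. Without such a
  condition a zonotope does not determine its generators up to order and sign: the
  $1 \times 2$ matrices $[1, 1]$ and $[0, 2]$ both generate the interval $[0,2]$.\<close>

definition no_parallel_columns :: "real ^ 'k ^ 'm \<Rightarrow> bool" where
  "no_parallel_columns A \<longleftrightarrow>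
     (\<forall>i j. i \<noteq> j \<longrightarrow> column i A \<noteq> 0 \<longrightarrow> column j A \<noteq> 0 \<longrightarrow>
        (\<nexists>c. column j A = c *\<^sub>R column i A))"

end

theory Submission
  imports Defs
begin

text \<open>
  Two matrices with equal Gram matrices differ by an isometry: \<open>A v \<mapsto> B v\<close> is well defined and
  norm preserving on the column space of \<open>A\<close>, and it extends to the whole space as long as the
  target has at least the dimension of the source (\<open>isometry_if_gram_eq\<close>). This gives the
  equivalence of the Gram and the factorization conditions. Permuting the generators does not
  change a zonotope, and reversing the sign of a generator translates it, so these conditions
  imply congruence.

  For the converse, a distance-preserving map is an affine isometry, so after moving \<open>A\<close> by its
  linear part, two zonotopes in one space are translates of each other. A translation does not
  change the extent of the zonotope in direction \<open>u\<close>, which for unit vectors \<open>u\<close> equals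
  \<open>\<Sum>\<^sub>i \<bar>a\<^sub>i \<bullet> u\<bar>\<close>. The heart of the proof is that this function of \<open>u\<close> determines the
  generators up to order and sign once no two of them are parallel. Each summand is linear away
  from the hyperplane \<open>a\<^sub>i\<^sup>\<bottom>\<close> and has a kink along it. At a point \<open>u\<close> that lies on the hyperplane
  \<open>a\<^sup>\<bottom>\<close>, and on no hyperplane belonging to a generator that is not parallel to \<open>a\<close>, a
  small second difference in direction \<open>a\<close> sees only the kinks of the generators parallel to \<open>a\<close>
  (\<open>second_difference_of_width\<close>). Hence the total length of the generators on each line
  can be read off from the zonotope. When each line carries at most one nonzero generator, this
  length determines the generator up to sign. The nonzero generators are thereby matched
  bijectively; since both families have the same index set, equally many zero generators remain,
  and the matching extends to a permutation (\<open>generators_determined_by_width\<close>).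

  The argument is carried out for families of vectors in inner product spaces; the matrix
  conditions are translated into statements about the families of columns.\<close>

section \<open>Distance-preserving maps\<close>

text \<open>Polarization turns preservation of distances into preservation of inner products; then
  \<open>q (x + y) - q x - q y\<close> has the same norm as \<open>(x + y) - x - y\<close>, which is zero.\<close>

lemma distance_preserving_affine:
  fixes f :: "'a::real_inner \<Rightarrow> 'b::real_inner"
  assumes dist: "\<And>x y. dist (f x) (f y) = dist x y"
  obtains q where "linear q" "\<And>x y. q x \<bullet> q y = x \<bullet> y" "\<And>x. f x = q x + f 0"
proof -
  define q where "q = (\<lambda>x. f x - f 0)"
  have norm_diff: "norm (q x - q y) = norm (x - y)" for x y
    using dist[of x y] by (simp add: q_def dist_norm)
  have norm: "norm (q x) = norm x" for x
    using norm_diff[of x 0] by (simp add: q_def)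
  have inner: "q x \<bullet> q y = x \<bullet> y" for x y
    using norm_diff[of x y] norm[of x] norm[of y] by (simp add: dot_norm_neg)
  have "linear q"
  proof (rule linearI)
    fix x y
    have "(q (x + y) - (q x + q y)) \<bullet> (q (x + y) - (q x + q y)) = 0"
      by (simp add: inner_diff_left inner_diff_right inner_add_left inner_add_right inner)
    then show "q (x + y) = q x + q y" by simp
  next
    fix c x
    have "(q (c *\<^sub>R x) - c *\<^sub>R q x) \<bullet> (q (c *\<^sub>R x) - c *\<^sub>R q x) = 0"
      by (simp add: inner_diff_left inner_diff_right inner)
    then show "q (c *\<^sub>R x) = c *\<^sub>R q x" by simp
  qed
  with inner show ?thesis by (intro that) (auto simp: q_def)
qed

section \<open>Zonotopes and their widths\<close>

text \<open>Working with families in arbitrary spaces allows linear maps to be applied to the generators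
  without passing through matrices.\<close>

definition generated_zonotope :: "('k::finite \<Rightarrow> 'a::real_vector) \<Rightarrow> 'a set" where
  "generated_zonotope a = {\<Sum>i\<in>UNIV. t i *\<^sub>R a i | t. \<forall>i. 0 \<le> t i \<and> t i \<le> (1::real)}"

text \<open>This is the extent of \<open>generated_zonotope a\<close> in direction \<open>u\<close>, scaled by \<open>norm u\<close>:
  by \<open>width_ge\<close> and \<open>width_attained\<close> it is the maximum of \<open>(z - z') \<bullet> u\<close> over points \<open>z\<close> and \<open>z'\<close> of the
  zonotope. Using differences of points makes it translation invariant.\<close>

definition width :: "('k::finite \<Rightarrow> 'a::real_inner) \<Rightarrow> 'a \<Rightarrow> real" where
  "width a u = (\<Sum>i\<in>UNIV. \<bar>a i \<bullet> u\<bar>)"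

lemma generated_zonotopeI:
  assumes "\<And>i. 0 \<le> t i \<and> t i \<le> 1"
  shows "(\<Sum>i\<in>UNIV. t i *\<^sub>R a i) \<in> generated_zonotope a"
  using assms unfolding generated_zonotope_def by blast

lemma width_ge:
  assumes "z \<in> generated_zonotope a" "z' \<in> generated_zonotope a"
  shows "(z - z') \<bullet> u \<le> width a u"
proof -
  obtain t t' where t: "z = (\<Sum>i\<in>UNIV. t i *\<^sub>R a i)" "\<And>i. 0 \<le> t i \<and> t i \<le> 1"
    and t': "z' = (\<Sum>i\<in>UNIV. t' i *\<^sub>R a i)" "\<And>i. 0 \<le> t' i \<and> t' i \<le> 1"
    using assms unfolding generated_zonotope_def by blast
  have "(z - z') \<bullet> u = (\<Sum>i\<in>UNIV. (t i - t' i) * (a i \<bullet> u))"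
    unfolding t t' by (simp add: inner_diff_left inner_sum_left sum_subtractf left_diff_distrib)
  also have "\<dots> \<le> (\<Sum>i\<in>UNIV. \<bar>a i \<bullet> u\<bar>)"
  proof (rule sum_mono)
    fix i
    have "\<bar>t i - t' i\<bar> \<le> 1" using t(2)[of i] t'(2)[of i] by (auto simp: abs_le_iff)
    then have "\<bar>(t i - t' i) * (a i \<bullet> u)\<bar> \<le> \<bar>a i \<bullet> u\<bar>"
      by (simp add: abs_mult mult_left_le_one_le)
    then show "(t i - t' i) * (a i \<bullet> u) \<le> \<bar>a i \<bullet> u\<bar>" by linarith
  qed
  finally show ?thesis by (simp add: width_def)
qed

lemma width_attained:
  obtains z z' where "z \<in> generated_zonotope a" "z' \<in> generated_zonotope a"
    "(z - z') \<bullet> u = width a u"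
proof
  let ?z = "\<Sum>i\<in>UNIV. (if a i \<bullet> u > 0 then 1 else 0) *\<^sub>R a i"
  let ?z' = "\<Sum>i\<in>UNIV. (if a i \<bullet> u < 0 then 1 else 0) *\<^sub>R a i"
  show "?z \<in> generated_zonotope a"
    by (rule generated_zonotopeI) simp
  show "?z' \<in> generated_zonotope a"
    by (rule generated_zonotopeI) simp
  show "(?z - ?z') \<bullet> u = width a u"
    by (auto simp: width_def inner_diff_left inner_sum_left sum_subtractf[symmetric] intro!: sum.cong)
qed

lemma width_eq_if_translate:
  assumes "generated_zonotope b = (\<lambda>x. x + c) ` generated_zonotope a"
  shows "width a u = width b u"
proof (rule antisym)
  obtain z z' where z: "z \<in> generated_zonotope a" "z' \<in> generated_zonotope a"
    and w: "(z - z') \<bullet> u = width a u" by (rule width_attained)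
  have "((z + c) - (z' + c)) \<bullet> u \<le> width b u"
    using z by (intro width_ge) (auto simp: assms)
  with w show "width a u \<le> width b u" by simp
next
  obtain z z' where z: "z \<in> generated_zonotope b" "z' \<in> generated_zonotope b"
    and w: "(z - z') \<bullet> u = width b u" by (rule width_attained)
  from z obtain x x' where x: "x \<in> generated_zonotope a" "x' \<in> generated_zonotope a"
    and "z = x + c" "z' = x' + c" by (auto simp: assms)
  then show "width b u \<le> width a u" using width_ge[OF x, of u] w by simp
qed

section \<open>Second differences of the width function\<close>

text \<open>A subspace is not covered by finitely many hyperplanes none of which contains it. To leave one
  more hyperplane, move along a vector \<open>p\<close> that is transversal to it; each hyperplane excludes
  at most one length of the move.\<close>

lemma avoid_finitely_many_hyperplanes:
  fixes W :: "'a::real_inner set"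
  assumes "subspace S" "finite W" "\<And>w. w \<in> W \<Longrightarrow> \<exists>p\<in>S. w \<bullet> p \<noteq> 0"
  shows "\<exists>u\<in>S. \<forall>w\<in>W. w \<bullet> u \<noteq> 0"
  using assms(2,3)
proof (induction W)
  case empty
  show ?case using subspace_0[OF assms(1)] by blast
next
  case (insert v W)
  then obtain u where u: "u \<in> S" "\<forall>w\<in>W. w \<bullet> u \<noteq> 0" by auto
  obtain p where p: "p \<in> S" "v \<bullet> p \<noteq> 0" using insert.prems by blast
  \<comment> \<open>If \<open>w \<bullet> p = 0\<close>, the value excluded for \<open>w\<close> is \<open>0\<close> by division by zero, which is harmless.\<close>
  obtain s where s: "s \<notin> (\<lambda>w. - (w \<bullet> u) / (w \<bullet> p)) ` insert v W"
    using ex_new_if_finite[OF infinite_UNIV_char_0, of "(\<lambda>w. - (w \<bullet> u) / (w \<bullet> p)) ` insert v W"]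
      insert.hyps(1) by auto
  have "w \<bullet> (u + s *\<^sub>R p) \<noteq> 0" if w: "w \<in> insert v W" for w
  proof (cases "w \<bullet> p = 0")
    case True
    with w p u show ?thesis by (auto simp: inner_add_right)
  next
    case False
    then have "s \<noteq> - (w \<bullet> u) / (w \<bullet> p)" using s w by blast
    with False show ?thesis by (auto simp: inner_add_right field_simps)
  qed
  moreover have "u + s *\<^sub>R p \<in> S"
    using assms(1) u p by (simp add: subspace_add subspace_scale)
  ultimately show ?case by blast
qed

text \<open>A vector \<open>u\<close> as needed for the second difference below: scaling up a vector orthogonal to \<open>a\<close>
  and to no vector of \<open>W\<close> makes the step \<open>a\<close> so small relative to \<open>u\<close> that the segment from
  \<open>u - a\<close> to \<open>u + a\<close> does not cross any of the hyperplanes \<open>w\<^sup>\<bottom>\<close>.\<close>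

lemma perpendicular_vector_dominating:
  fixes a :: "'a::real_inner"
  assumes "finite W" and "a \<noteq> 0" and nonpar: "\<And>w. w \<in> W \<Longrightarrow> \<nexists>c. w = c *\<^sub>R a"
  obtains u where "a \<bullet> u = 0" "\<And>w. w \<in> W \<Longrightarrow> \<bar>w \<bullet> a\<bar> \<le> \<bar>w \<bullet> u\<bar>"
proof -
  have "\<exists>p\<in>{x. a \<bullet> x = 0}. w \<bullet> p \<noteq> 0" if "w \<in> W" for w
  proof
    \<comment> \<open>The part of \<open>w\<close> orthogonal to \<open>a\<close> is nonzero because \<open>w\<close> is not a multiple of \<open>a\<close>.\<close>
    define p where "p = w - ((w \<bullet> a) / (a \<bullet> a)) *\<^sub>R a"
    show ap: "p \<in> {x. a \<bullet> x = 0}"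
      using \<open>a \<noteq> 0\<close> by (simp add: p_def inner_diff_right inner_commute)
    have "p \<noteq> 0" using nonpar[OF that] by (auto simp: p_def)
    moreover have "w \<bullet> p = p \<bullet> p"
      using ap by (subst (2) p_def) (simp add: inner_diff_left)
    ultimately show "w \<bullet> p \<noteq> 0" by simp
  qed
  with avoid_finitely_many_hyperplanes[OF subspace_hyperplane \<open>finite W\<close>]
  obtain u where u: "a \<bullet> u = 0" "\<forall>w\<in>W. w \<bullet> u \<noteq> 0" by blast
  define M where "M = (\<Sum>w\<in>W. \<bar>w \<bullet> a\<bar> / \<bar>w \<bullet> u\<bar>)"
  have "\<bar>w \<bullet> a\<bar> \<le> \<bar>w \<bullet> (M *\<^sub>R u)\<bar>" if "w \<in> W" for w
  proof -
    have "\<bar>w \<bullet> a\<bar> / \<bar>w \<bullet> u\<bar> \<le> M"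
      unfolding M_def using \<open>finite W\<close> that by (intro member_le_sum) auto
    moreover have "M \<ge> 0" by (simp add: M_def sum_nonneg)
    ultimately show ?thesis using u(2) that by (simp add: field_simps abs_mult)
  qed
  with u(1) show ?thesis by (intro that[of "M *\<^sub>R u"]) auto
qed

text \<open>The function \<open>\<bar>v i \<bullet> _\<bar>\<close> is linear on the segment from \<open>u - a\<close> to \<open>u + a\<close> unless \<open>v i\<close> is
  parallel to \<open>a\<close>, so its second difference vanishes there. For \<open>v i\<close> parallel to \<open>a\<close> the middle
  value is zero and both ends contribute \<open>\<bar>v i \<bullet> a\<bar>\<close>.\<close>

lemma second_difference_of_width:
  fixes v :: "'k::finite \<Rightarrow> 'a::real_inner"
  assumes au: "a \<bullet> u = 0"
    and dom: "\<And>i. \<nexists>c. v i = c *\<^sub>R a \<Longrightarrow> \<bar>v i \<bullet> a\<bar> \<le> \<bar>v i \<bullet> u\<bar>"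
  shows "width v (u + a) + width v (u - a) - 2 * width v u
           = 2 * (\<Sum>i | \<exists>c. v i = c *\<^sub>R a. \<bar>v i \<bullet> a\<bar>)"
proof -
  have abs_flat: "\<bar>x + y\<bar> + \<bar>x - y\<bar> - 2 * \<bar>x\<bar> = 0" if "\<bar>y\<bar> \<le> \<bar>x\<bar>" for x y :: real
    using that by linarith
  have summand: "\<bar>v i \<bullet> (u + a)\<bar> + \<bar>v i \<bullet> (u - a)\<bar> - 2 * \<bar>v i \<bullet> u\<bar>
      = (if \<exists>c. v i = c *\<^sub>R a then 2 * \<bar>v i \<bullet> a\<bar> else 0)" for i
  proof (cases "\<exists>c. v i = c *\<^sub>R a")
    case True
    then have "v i \<bullet> u = 0" using au by auto
    with True show ?thesis by (simp add: inner_add_right inner_diff_right)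
  next
    case False
    then show ?thesis
      using abs_flat[OF dom[of i]] by (simp add: inner_add_right inner_diff_right)
  qed
  have "width v (u + a) + width v (u - a) - 2 * width v u
      = (\<Sum>i\<in>UNIV. \<bar>v i \<bullet> (u + a)\<bar> + \<bar>v i \<bullet> (u - a)\<bar> - 2 * \<bar>v i \<bullet> u\<bar>)"
    by (simp add: width_def sum.distrib sum_subtractf sum_distrib_left)
  also have "\<dots> = (\<Sum>i | \<exists>c. v i = c *\<^sub>R a. 2 * \<bar>v i \<bullet> a\<bar>)"
    unfolding summand by (simp add: sum.If_cases)
  finally show ?thesis by (simp add: sum_distrib_left)
qed

text \<open>Up to the factor \<open>norm a\<close>, the sum measures the total length of the generators on the line
  spanned by \<open>a\<close>. One vector \<open>u\<close> is chosen to be generic for both families at once.\<close>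

lemma parallel_weight_eq:
  fixes v w :: "'k::finite \<Rightarrow> 'a::real_inner"
  assumes "\<And>u. width v u = width w u" and "a \<noteq> 0"
  shows "(\<Sum>i | \<exists>c. v i = c *\<^sub>R a. \<bar>v i \<bullet> a\<bar>) = (\<Sum>i | \<exists>c. w i = c *\<^sub>R a. \<bar>w i \<bullet> a\<bar>)"
proof -
  define W where "W = {x \<in> range v \<union> range w. \<nexists>c. x = c *\<^sub>R a}"
  have "finite W" by (simp add: W_def)
  then obtain u where u: "a \<bullet> u = 0" "\<And>x. x \<in> W \<Longrightarrow> \<bar>x \<bullet> a\<bar> \<le> \<bar>x \<bullet> u\<bar>"
    using perpendicular_vector_dominating[of W a] \<open>a \<noteq> 0\<close> W_def by blast
  have "2 * (\<Sum>i | \<exists>c. v i = c *\<^sub>R a. \<bar>v i \<bullet> a\<bar>) = 2 * (\<Sum>i | \<exists>c. w i = c *\<^sub>R a. \<bar>w i \<bullet> a\<bar>)"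
    using second_difference_of_width[OF u(1), of v] second_difference_of_width[OF u(1), of w]
    by (simp add: W_def u(2) assms(1))
  then show ?thesis by simp
qed

section \<open>Recovering the generators from the width function\<close>

definition pairwise_nonparallel :: "('k \<Rightarrow> 'a::real_vector) \<Rightarrow> bool" where
  "pairwise_nonparallel v \<longleftrightarrow>
     (\<forall>i j. i \<noteq> j \<longrightarrow> v i \<noteq> 0 \<longrightarrow> v j \<noteq> 0 \<longrightarrow> (\<nexists>c. v j = c *\<^sub>R v i))"

lemma sum_over_line:
  fixes v :: "'k::finite \<Rightarrow> 'a::real_inner"
  assumes "pairwise_nonparallel v" "v i = c *\<^sub>R a" "v i \<noteq> 0"
  shows "(\<Sum>j | \<exists>c. v j = c *\<^sub>R a. \<bar>v j \<bullet> a\<bar>) = \<bar>v i \<bullet> a\<bar>"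
proof -
  have "v j = 0" if "j \<noteq> i" "v j = d *\<^sub>R a" for j d
  proof (rule ccontr)
    assume "v j \<noteq> 0"
    moreover have "v j = (d / c) *\<^sub>R v i" using assms that by auto
    ultimately show False
      using assms(1,3) that(1) unfolding pairwise_nonparallel_def by metis
  qed
  then have "(\<Sum>j | \<exists>c. v j = c *\<^sub>R a. \<bar>v j \<bullet> a\<bar>) = (\<Sum>j\<in>{i}. \<bar>v j \<bullet> a\<bar>)"
    using assms(2) by (intro sum.mono_neutral_right) (simp, blast, force)
  then show ?thesis by simp
qed

text \<open>On the line spanned by \<open>v i\<close> the family \<open>v\<close> has positive total length, so \<open>w\<close> has a nonzero
  generator on it. Each family has only one, so their lengths agree.\<close>

lemma generator_occurs_up_to_sign:
  fixes v w :: "'k::finite \<Rightarrow> 'a::real_inner"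
  assumes "\<And>u. width v u = width w u"
    and "pairwise_nonparallel v" "pairwise_nonparallel w" "v i \<noteq> 0"
  shows "\<exists>j. w j = v i \<or> w j = - v i"
proof -
  let ?L = "{j. \<exists>c. w j = c *\<^sub>R v i}"
  have weight: "(\<Sum>j\<in>?L. \<bar>w j \<bullet> v i\<bar>) = \<bar>v i \<bullet> v i\<bar>"
    using parallel_weight_eq[OF assms(1) assms(4)]
      sum_over_line[OF assms(2) _ assms(4), of 1 "v i"] by simp
  have "\<exists>j\<in>?L. w j \<bullet> v i \<noteq> 0"
  proof (rule ccontr)
    assume "\<not> ?thesis"
    then have "(\<Sum>j\<in>?L. \<bar>w j \<bullet> v i\<bar>) = 0" by (intro sum.neutral) auto
    with weight assms(4) show False by simp
  qed
  then obtain j c where j: "w j = c *\<^sub>R v i" "w j \<bullet> v i \<noteq> 0" by blast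
  then have "w j \<noteq> 0" by auto
  then have "\<bar>w j \<bullet> v i\<bar> = \<bar>v i \<bullet> v i\<bar>"
    using sum_over_line[OF assms(3) j(1)] weight by simp
  then have "\<bar>c\<bar> = 1" using j(1) assms(4) by (simp add: abs_mult)
  then have "c = 1 \<or> c = - 1" by linarith
  with j(1) show ?thesis by auto
qed

text \<open>The complements of \<open>S\<close> and \<open>T\<close> have the same cardinality and can be matched arbitrarily. The
  last conclusion is what pairs zero generators with zero generators.\<close>

lemma partial_injection_extends_to_permutation:
  fixes p :: "'k::finite \<Rightarrow> 'k"
  assumes "bij_betw p S T"
  obtains \<pi> where "\<pi> permutes UNIV" "\<And>i. i \<in> S \<Longrightarrow> \<pi> i = p i" "\<And>i. i \<notin> S \<Longrightarrow> \<pi> i \<notin> T"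
proof -
  have "card (- S) = card (- T)"
    using bij_betw_same_card[OF assms] by (simp add: Compl_eq_Diff_UNIV card_Diff_subset)
  then obtain q where q: "bij_betw q (- S) (- T)"
    using finite_same_card_bij[of "- S" "- T"] by auto
  let ?\<pi> = "\<lambda>i. if i \<in> S then p i else q i"
  have "bij_betw ?\<pi> (S \<union> - S) (T \<union> - T)"
    using assms q by (intro bij_betw_disjoint_Un) (auto simp: bij_betw_def inj_on_def)
  then have "?\<pi> permutes UNIV" by (intro bij_imp_permutes) (auto simp: Un_commute)
  moreover have "?\<pi> i \<notin> T" if "i \<notin> S" for i
    using that q by (auto simp: bij_betw_def)
  ultimately show ?thesis by (intro that[of ?\<pi>]) simp_all
qed

lemma generators_determined_by_width:
  fixes v w :: "'k::finite \<Rightarrow> 'a::real_inner"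
  assumes width: "\<And>u. width v u = width w u"
    and v: "pairwise_nonparallel v" and w: "pairwise_nonparallel w"
  obtains \<pi> s where "\<pi> permutes UNIV" "\<And>j. s j = 1 \<or> s j = (- 1 :: real)"
    "\<And>j. w j = s j *\<^sub>R v (\<pi> j)"
proof -
  have ex: "\<exists>i. w j = v i \<or> w j = - v i" if "w j \<noteq> 0" for j
    using generator_occurs_up_to_sign[OF width[symmetric] w v that] by (metis minus_minus)
  have ex': "\<exists>j. v i = w j \<or> v i = - w j" if "v i \<noteq> 0" for i
    using generator_occurs_up_to_sign[OF width v w that] by (metis minus_minus)
  obtain p where p: "\<And>j. w j \<noteq> 0 \<Longrightarrow> w j = v (p j) \<or> w j = - v (p j)"
    using ex by metis
  \<comment> \<open>Within one family, equality up to sign is a special case of being parallel.\<close>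
  have unique: "i = j" if "x i \<noteq> 0" "x i = x j \<or> x i = - x j" "pairwise_nonparallel x"
    for x :: "'k \<Rightarrow> 'a" and i j
  proof (rule ccontr)
    assume "i \<noteq> j"
    moreover have "x j \<noteq> 0" "x i = 1 *\<^sub>R x j \<or> x i = (- 1) *\<^sub>R x j" using that by auto
    ultimately show False using that unfolding pairwise_nonparallel_def by metis
  qed
  have "bij_betw p {j. w j \<noteq> 0} {i. v i \<noteq> 0}"
  proof (rule bij_betw_imageI)
    show "inj_on p {j. w j \<noteq> 0}"
    proof (rule inj_onI)
      fix i j assume "i \<in> {j. w j \<noteq> 0}" "j \<in> {j. w j \<noteq> 0}" "p i = p j"
      then have "w i \<noteq> 0" "w i = w j \<or> w i = - w j"
        using p[of i] p[of j] by auto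
      then show "i = j" using unique[of w] w by blast
    qed
    have "i \<in> p ` {j. w j \<noteq> 0}" if i: "v i \<noteq> 0" for i
    proof -
      obtain j where j: "v i = w j \<or> v i = - w j" using ex'[OF i] by blast
      then have "w j \<noteq> 0" using i by auto
      moreover from this have "v i = v (p j) \<or> v i = - v (p j)" using p[of j] j by auto
      then have "i = p j" using unique[of v] i v by blast
      ultimately show ?thesis by blast
    qed
    moreover have "v (p j) \<noteq> 0" if "w j \<noteq> 0" for j using p[OF that] that by auto
    ultimately show "p ` {j. w j \<noteq> 0} = {i. v i \<noteq> 0}" by blast
  qed
  then obtain \<pi> where \<pi>: "\<pi> permutes UNIV" "\<And>j. w j \<noteq> 0 \<Longrightarrow> \<pi> j = p j"
    "\<And>j. w j = 0 \<Longrightarrow> v (\<pi> j) = 0"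
    by (rule partial_injection_extends_to_permutation) auto
  let ?s = "\<lambda>j. if w j = v (\<pi> j) then 1 else - 1 :: real"
  have "w j = ?s j *\<^sub>R v (\<pi> j)" for j
    using \<pi>(2,3)[of j] p[of j] by (cases "w j = 0") auto
  with \<pi>(1) show ?thesis by (intro that[of \<pi> ?s]) auto
qed

section \<open>Equality of Gram matrices up to signed permutations\<close>

text \<open>The Gram condition of the theorem for the families of columns. Only inner products occur, so
  the two families may live in different spaces and the relation can be reversed without any
  comparison of dimensions.\<close>

definition signed_gram_equiv :: "('k \<Rightarrow> 'a::real_inner) \<Rightarrow> ('k \<Rightarrow> 'b::real_inner) \<Rightarrow> bool" where
  "signed_gram_equiv a b \<longleftrightarrow>
     (\<exists>\<pi> s. \<pi> permutes UNIV \<and> (\<forall>i. s i = 1 \<or> s i = (- 1 :: real)) \<and>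
        (\<forall>i j. b i \<bullet> b j = (s i *\<^sub>R a (\<pi> i)) \<bullet> (s j *\<^sub>R a (\<pi> j))))"

lemma signed_gram_equiv_sym:
  fixes a :: "'k \<Rightarrow> 'a::real_inner" and b :: "'k \<Rightarrow> 'b::real_inner"
  assumes "signed_gram_equiv a b"
  shows "signed_gram_equiv b a"
proof -
  obtain \<pi> s where \<pi>: "\<pi> permutes UNIV" and s: "\<And>i. s i = 1 \<or> s i = (- 1 :: real)"
    and gram: "\<And>i j. b i \<bullet> b j = (s i *\<^sub>R a (\<pi> i)) \<bullet> (s j *\<^sub>R a (\<pi> j))"
    using assms unfolding signed_gram_equiv_def by blast
  let ?\<rho> = "inv \<pi>" let ?r = "\<lambda>i. s (inv \<pi> i)"
  have sq: "s i * s i = 1" for i using s[of i] by auto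
  have "a i \<bullet> a j = (?r i *\<^sub>R b (?\<rho> i)) \<bullet> (?r j *\<^sub>R b (?\<rho> j))" for i j
  proof -
    have "(?r i *\<^sub>R b (?\<rho> i)) \<bullet> (?r j *\<^sub>R b (?\<rho> j))
        = (?r i * ?r i) * (?r j * ?r j) * (a i \<bullet> a j)"
      by (simp add: gram permutes_inverses[OF \<pi>])
    then show ?thesis by (simp add: sq)
  qed
  with \<pi> s show ?thesis
    unfolding signed_gram_equiv_def
    by (intro exI[of _ ?\<rho>] exI[of _ ?r]) (auto intro: permutes_inv)
qed

lemma generated_zonotope_linear_image:
  assumes "linear q"
  shows "generated_zonotope (\<lambda>i. q (a i)) = q ` generated_zonotope a"
proof -
  have "(\<Sum>i\<in>UNIV. t i *\<^sub>R q (a i)) = q (\<Sum>i\<in>UNIV. t i *\<^sub>R a i)" for t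
    using assms by (simp add: linear_sum linear_scale)
  then show ?thesis unfolding generated_zonotope_def by auto
qed

text \<open>The linear part \<open>q\<close> of the isometry maps \<open>a\<close> to a family with the same inner products whose
  zonotope is a translate of that of \<open>b\<close>; the width function then identifies the two families.\<close>

lemma signed_gram_equiv_if_isometric:
  fixes a :: "'k::finite \<Rightarrow> 'a::real_inner" and b :: "'k \<Rightarrow> 'b::real_inner"
  assumes dist: "\<And>x y. dist (f x) (f y) = dist x y"
    and image: "f ` generated_zonotope a = generated_zonotope b"
    and a: "pairwise_nonparallel a" and b: "pairwise_nonparallel b"
  shows "signed_gram_equiv a b"
proof -
  obtain q where q: "linear q" "\<And>x y. q x \<bullet> q y = x \<bullet> y" "\<And>x. f x = q x + f 0"
    using distance_preserving_affine[OF dist] by blast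
  have inj: "x = y" if "q x = q y" for x y
    using dist[of x y] that q(3)[of x] q(3)[of y] by simp
  have "generated_zonotope b = (\<lambda>x. x + f 0) ` generated_zonotope (\<lambda>i. q (a i))"
    unfolding generated_zonotope_linear_image[OF q(1)] image_image image[symmetric]
    by (rule image_cong[OF refl q(3)])
  then have "\<And>u. width (\<lambda>i. q (a i)) u = width b u" by (rule width_eq_if_translate)
  moreover have "pairwise_nonparallel (\<lambda>i. q (a i))"
    using a inj linear_0[OF q(1)] linear_scale[OF q(1)]
    unfolding pairwise_nonparallel_def by metis
  ultimately obtain \<pi> s where "\<pi> permutes UNIV" "\<And>j. s j = 1 \<or> s j = (- 1 :: real)"
    "\<And>j. b j = s j *\<^sub>R q (a (\<pi> j))"
    using generators_determined_by_width b by blast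
  then show ?thesis
    unfolding signed_gram_equiv_def by (intro exI[of _ \<pi>] exI[of _ s]) (simp add: q(2))
qed

text \<open>Replacing a generator \<open>x\<close> by \<open>- x\<close> and its coefficient \<open>t\<close> by \<open>1 - t\<close> shifts its term by
  a constant: \<open>t (- x) = (1 - t) x - x\<close>. The coefficient \<open>1 - t\<close> again ranges over the unit
  interval.\<close>

lemma signed_permutation_translates:
  fixes a :: "'k::finite \<Rightarrow> 'a::real_vector"
  assumes \<pi>: "\<pi> permutes UNIV" and s: "\<And>j. s j = 1 \<or> s j = (- 1 :: real)"
  obtains c where "generated_zonotope (\<lambda>j. s j *\<^sub>R a (\<pi> j)) = (\<lambda>x. x + c) ` generated_zonotope a"
proof
  let ?c = "\<Sum>j\<in>UNIV. ((s j - 1) / 2) *\<^sub>R a (\<pi> j)"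
  \<comment> \<open>Equals \<open>t\<close> for sign \<open>1\<close> and \<open>1 - t\<close> for sign \<open>-1\<close>; either way it is an involution.\<close>
  let ?flip = "\<lambda>j t. s j * t + (1 - s j) / 2"
  have reindex: "(\<Sum>j\<in>UNIV. t (\<pi> j) *\<^sub>R a (\<pi> j)) = (\<Sum>i\<in>UNIV. t i *\<^sub>R a i)" for t :: "'k \<Rightarrow> real"
    using sum.permute[OF \<pi>, of "\<lambda>i. t i *\<^sub>R a i"] by (simp add: o_def)
  have shift: "(\<Sum>j\<in>UNIV. t j *\<^sub>R s j *\<^sub>R a (\<pi> j)) = (\<Sum>j\<in>UNIV. ?flip j (t j) *\<^sub>R a (\<pi> j)) + ?c" for t
  proof -
    have "t j *\<^sub>R s j *\<^sub>R a (\<pi> j) = ?flip j (t j) *\<^sub>R a (\<pi> j) + ((s j - 1) / 2) *\<^sub>R a (\<pi> j)" for j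
      unfolding scaleR_left_distrib[symmetric] scaleR_scaleR
      by (rule arg_cong[of _ _ "\<lambda>x. x *\<^sub>R a (\<pi> j)"]) (simp add: field_simps)
    then show ?thesis by (simp add: sum.distrib)
  qed
  have flip: "0 \<le> ?flip j t \<and> ?flip j t \<le> 1" if "0 \<le> t \<and> t \<le> 1" for j t
    using s[of j] that by auto
  have flip2: "?flip j (?flip j t) = t" for j t using s[of j] by auto
  show "generated_zonotope (\<lambda>j. s j *\<^sub>R a (\<pi> j)) = (\<lambda>x. x + ?c) ` generated_zonotope a"
  proof (intro equalityI subsetI)
    fix z assume "z \<in> generated_zonotope (\<lambda>j. s j *\<^sub>R a (\<pi> j))"
    then obtain t where t: "\<And>i. 0 \<le> t i \<and> t i \<le> 1" "z = (\<Sum>j\<in>UNIV. t j *\<^sub>R s j *\<^sub>R a (\<pi> j))"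
      unfolding generated_zonotope_def by auto
    let ?t = "\<lambda>i. ?flip (inv \<pi> i) (t (inv \<pi> i))"
    have "z = (\<Sum>i\<in>UNIV. ?t i *\<^sub>R a i) + ?c"
      unfolding reindex[symmetric] t(2) shift by (simp add: permutes_inverses[OF \<pi>])
    moreover have "(\<Sum>i\<in>UNIV. ?t i *\<^sub>R a i) \<in> generated_zonotope a"
      by (intro generated_zonotopeI flip t(1))
    ultimately show "z \<in> (\<lambda>x. x + ?c) ` generated_zonotope a" by blast
  next
    fix z assume "z \<in> (\<lambda>x. x + ?c) ` generated_zonotope a"
    then obtain t where t: "\<And>i. 0 \<le> t i \<and> t i \<le> 1" "z = (\<Sum>i\<in>UNIV. t i *\<^sub>R a i) + ?c"
      unfolding generated_zonotope_def by auto
    let ?t = "\<lambda>j. ?flip j (t (\<pi> j))"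
    have "z = (\<Sum>j\<in>UNIV. ?t j *\<^sub>R s j *\<^sub>R a (\<pi> j))"
      unfolding shift flip2 reindex by (rule t(2))
    also have "\<dots> \<in> generated_zonotope (\<lambda>j. s j *\<^sub>R a (\<pi> j))"
      by (intro generated_zonotopeI flip t(1))
    finally show "z \<in> generated_zonotope (\<lambda>j. s j *\<^sub>R a (\<pi> j))" .
  qed
qed

section \<open>Extending partial isometries\<close>

text \<open>The projection is the Fourier expansion along an orthogonal basis of \<open>S\<close>; this formula makes
  its linearity evident.\<close>

lemma orthogonal_projection_exists:
  fixes S :: "'a::euclidean_space set"
  assumes "subspace S"
  obtains p where "linear p" "\<And>x. p x \<in> S" "\<And>x y. y \<in> S \<Longrightarrow> (x - p x) \<bullet> y = 0"
proof -
  obtain C where C: "pairwise orthogonal C" "independent C" "span C = S" "C \<subseteq> S"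
    using orthogonal_basis_subspace[OF assms] by metis
  have fin: "finite C" using C(2) by (rule independent_imp_finite)
  let ?p = "\<lambda>x. \<Sum>b\<in>C. (b \<bullet> x / (b \<bullet> b)) *\<^sub>R b"
  have "linear ?p"
    by (rule linearI)
      (simp_all add: inner_add_right add_divide_distrib scaleR_left_distrib sum.distrib scaleR_sum_right)
  moreover have "?p x \<in> S" for x
    unfolding C(3)[symmetric] by (intro span_sum span_scale span_base)
  moreover have "(x - ?p x) \<bullet> y = 0" if "y \<in> S" for x y
    using Gram_Schmidt_step[OF C(1), of y x] that C(3) by (simp add: orthogonal_def inner_commute)
  ultimately show ?thesis by (rule that)
qed

text \<open>The orthogonal complement of \<open>S\<close> has at most the dimension of the orthogonal complement of
  \<open>f ` S\<close>, so it embeds isometrically there. The sum of \<open>f\<close> on the \<open>S\<close>-component and this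
  embedding on the orthogonal component is an isometry by Pythagoras.\<close>

lemma isometry_on_subspace_extends:
  fixes f :: "'a::euclidean_space \<Rightarrow> 'b::euclidean_space"
  assumes S: "subspace S" and f: "linear f" and norm: "\<And>x. x \<in> S \<Longrightarrow> norm (f x) = norm x"
    and dim: "DIM('a) \<le> DIM('b)"
  obtains q where "linear q" "\<And>x. norm (q x) = norm x" "\<And>x. x \<in> S \<Longrightarrow> q x = f x"
proof -
  define S' where "S' = {y. \<forall>x\<in>S. orthogonal x y}"
  define T' where "T' = {y. \<forall>x\<in>f ` S. orthogonal x y}"
  have T: "subspace (f ` S)" using f S by (rule linear_subspace_image)
  have sub: "subspace S'" "subspace T'"
    unfolding S'_def T'_def by (rule subspace_orthogonal_to_vectors)+
  have "dim S' + dim S = DIM('a)"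
    using dim_subspace_orthogonal_to_vectors[OF S subspace_UNIV] by (simp add: S'_def)
  moreover have "dim T' + dim (f ` S) = DIM('b)"
    using dim_subspace_orthogonal_to_vectors[OF T subspace_UNIV] by (simp add: T'_def)
  moreover have "dim (f ` S) \<le> dim S" using f by (rule dim_image_le)
  ultimately have "dim S' \<le> dim T'" using dim by linarith
  then obtain h where h: "linear h" "h \<in> S' \<rightarrow> T'" "\<And>x. x \<in> S' \<Longrightarrow> norm (h x) = norm x"
    using isometry_subset_subspace[OF sub] by blast
  obtain p where p: "linear p" "\<And>x. p x \<in> S" "\<And>x y. y \<in> S \<Longrightarrow> (x - p x) \<bullet> y = 0"
    using orthogonal_projection_exists[OF S] by blast
  have perp: "x - p x \<in> S'" for x
    using p(3) by (auto simp: S'_def orthogonal_def inner_commute)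
  define q where "q = (\<lambda>x. f (p x) + h (x - p x))"
  have "linear q"
    using f h(1) p(1)
    by (intro linearI)
      (simp_all add: q_def linear_add linear_diff linear_scale scaleR_right_distrib scaleR_right_diff_distrib)
  moreover have "norm (q x) = norm x" for x
  proof -
    have "h (x - p x) \<in> T'" using h(2) perp by blast
    then have "orthogonal (f (p x)) (h (x - p x))" using p(2) by (auto simp: T'_def)
    then have "(norm (q x))\<^sup>2 = (norm (p x))\<^sup>2 + (norm (x - p x))\<^sup>2"
      by (simp add: q_def norm_add_Pythagorean norm p(2) h(3) perp)
    also have "\<dots> = (norm (p x + (x - p x)))\<^sup>2"
      using p(2) p(3)[of "p x" x]
      by (intro norm_add_Pythagorean[symmetric]) (auto simp: orthogonal_def inner_commute)
    finally show ?thesis by simp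
  qed
  moreover have "q x = f x" if "x \<in> S" for x
  proof -
    have "(x - p x) \<bullet> (x - p x) = 0" using p(3) subspace_diff[OF S that p(2)] by blast
    then have "p x = x" by simp
    then show ?thesis using linear_0[OF h(1)] by (simp add: q_def)
  qed
  ultimately show ?thesis by (rule that)
qed

text \<open>Let \<open>U\<close> and \<open>V\<close> form linear combinations of the two families. Equal Gram matrices mean that
  \<open>U v\<close> and \<open>V v\<close> always have the same norm; in particular the kernel of \<open>U\<close> lies in that of
  \<open>V\<close>, so \<open>V\<close> factors through \<open>U\<close> on its range. The factor is a partial isometry, which extends.\<close>

lemma isometry_if_gram_eq:
  fixes a :: "'k::finite \<Rightarrow> 'a::euclidean_space" and b :: "'k \<Rightarrow> 'b::euclidean_space"
  assumes gram: "\<And>i j. b i \<bullet> b j = a i \<bullet> a j" and dim: "DIM('a) \<le> DIM('b)"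
  obtains q where "linear q" "\<And>x. norm (q x) = norm x" "\<And>i. b i = q (a i)"
proof -
  define U where "U = (\<lambda>v :: real ^ 'k. \<Sum>i\<in>UNIV. (v $ i) *\<^sub>R a i)"
  define V where "V = (\<lambda>v :: real ^ 'k. \<Sum>i\<in>UNIV. (v $ i) *\<^sub>R b i)"
  have lin: "linear U" "linear V"
    unfolding U_def V_def
    by (auto intro!: linearI simp: scaleR_left_distrib sum.distrib scaleR_sum_right)
  have norm: "norm (V v) = norm (U v)" for v
    by (simp add: norm_eq_sqrt_inner U_def V_def inner_sum_left inner_sum_right gram)
  obtain g where g: "linear g" "\<And>v. U (g (U v)) = U v"
    using linear_exists_right_inverse_on[OF lin(1) subspace_UNIV] by auto
  \<comment> \<open>The vector \<open>g (U v) - v\<close> lies in the kernel of \<open>U\<close>, hence in that of \<open>V\<close>.\<close>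
  have factor: "V (g (U v)) = V v" for v
    using norm[of "g (U v) - v"] g(2)[of v] by (simp add: linear_diff lin)
  have "subspace (range U)" using lin(1) by (simp add: linear_subspace_image)
  moreover have "linear (V \<circ> g)" using g(1) lin(2) by (rule linear_compose)
  moreover have "norm ((V \<circ> g) x) = norm x" if "x \<in> range U" for x
    using that by (auto simp: factor norm g(2))
  ultimately obtain q where q: "linear q" "\<And>x. norm (q x) = norm x"
    "\<And>x. x \<in> range U \<Longrightarrow> q x = (V \<circ> g) x"
    using isometry_on_subspace_extends dim by blast
  have axis: "U (axis i 1) = a i" "V (axis i 1) = b i" for i
    by (simp_all add: U_def V_def axis_def if_distrib[of "\<lambda>x. x *\<^sub>R _"] cong: if_cong)
  have "b i = q (a i)" for i
    using q(3)[of "a i"] factor[of "axis i 1"] axis[of i] by (metis comp_apply rangeI)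
  with q show ?thesis by (intro that) auto
qed

section \<open>From families of vectors to matrices\<close>

lemma zonotope_eq_generated: "zonotope A = generated_zonotope (\<lambda>i. column i A)"
  by (simp add: zonotope_def generated_zonotope_def)

lemma no_parallel_columns_iff: "no_parallel_columns A \<longleftrightarrow> pairwise_nonparallel (\<lambda>i. column i A)"
  by (simp add: no_parallel_columns_def pairwise_nonparallel_def)

lemma column_matrix_mult: "column j (Q ** A) = Q *v column j (A :: real ^ 'k ^ 'm)"
  by (simp add: matrix_matrix_mult_def matrix_vector_mult_def column_def vec_eq_iff)

lemma column_signed_permutation:
  fixes A :: "real ^ 'k ^ 'm"
  assumes "\<Sigma> = (\<chi> i j. if i = \<pi> j then 1 else 0)" "sign_matrix J"
  shows "column j (A ** \<Sigma> ** J) = (J $ j $ j) *\<^sub>R column (\<pi> j) A"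
proof -
  have off_diagonal: "J $ k $ j = 0" if "k \<noteq> j" for k
    using assms(2) that unfolding sign_matrix_def by blast
  have "(A ** \<Sigma> ** J) $ i $ j = (\<Sum>k\<in>UNIV. (A ** \<Sigma>) $ i $ k * J $ k $ j)" for i
    by (subst matrix_matrix_mult_def) simp
  also have "\<dots> i = (\<Sum>k\<in>{j}. (A ** \<Sigma>) $ i $ k * J $ k $ j)" for i
    by (rule sum.mono_neutral_right) (auto simp: off_diagonal)
  finally have "(A ** \<Sigma> ** J) $ i $ j = (A ** \<Sigma>) $ i $ j * J $ j $ j" for i
    by simp
  moreover have "(A ** \<Sigma>) $ i $ j = A $ i $ \<pi> j" for i
    by (simp add: matrix_matrix_mult_def assms(1) if_distrib[of "\<lambda>x. _ * x"] cong: if_cong)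
  ultimately show ?thesis by (simp add: vec_eq_iff column_def mult.commute)
qed

lemma gram_iff:
  fixes A :: "real ^ 'k ^ 'm" and B :: "real ^ 'k ^ 'n"
  shows "transpose A ** A = transpose B ** B \<longleftrightarrow>
    (\<forall>i j. column i B \<bullet> column j B = column i A \<bullet> column j A)"
  by (auto simp: matrix_mult_transpose_dot_column vec_eq_iff)

lemma orthonormal_columns_iff:
  fixes Q :: "real ^ 'm ^ 'n"
  shows "orthonormal_columns Q \<longleftrightarrow> (\<forall>x. norm (Q *v x) = norm x)"
proof -
  have gram: "orthonormal_columns Q \<longleftrightarrow> transpose Q ** Q = mat 1"
    unfolding orthonormal_columns_def matrix_mult_transpose_dot_column
    by (auto simp: vec_eq_iff mat_def norm_eq_1 orthogonal_def)
  have pull: "(Q *v x) \<bullet> (Q *v y) = x \<bullet> (transpose Q ** Q *v y)" for x y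
    by (metis dot_lmul_matrix matrix_vector_mul_assoc transpose_matrix_vector
        vector_transpose_matrix)
  show ?thesis
  proof
    assume "orthonormal_columns Q"
    then show "\<forall>x. norm (Q *v x) = norm x"
      using pull by (simp add: gram norm_eq_sqrt_inner)
  next
    assume n: "\<forall>x. norm (Q *v x) = norm x"
    have "x \<bullet> (transpose Q ** Q *v y) = x \<bullet> (mat 1 *v y)" for x y
      using n matrix_vector_right_distrib[of Q x y]
      by (metis dot_norm matrix_vector_mul_lid pull)
    then have "transpose Q ** Q *v y = mat 1 *v y" for y by (metis vector_eq_ldot)
    then show "orthonormal_columns Q" by (simp add: gram matrix_eq)
  qed
qed

lemma gram_iff_signed_gram_equiv:
  fixes A :: "real ^ 'k ^ 'm" and B :: "real ^ 'k ^ 'n"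
  shows "(\<exists>(\<Sigma> :: real ^ 'k ^ 'k) J A'. permutation_matrix \<Sigma> \<and> sign_matrix J \<and>
      A' = A ** \<Sigma> ** J \<and> transpose A' ** A' = transpose B ** B)
    \<longleftrightarrow> signed_gram_equiv (\<lambda>i. column i A) (\<lambda>i. column i B)" (is "?gram \<longleftrightarrow> ?equiv")
proof
  assume ?gram
  then obtain \<Sigma> J :: "real ^ 'k ^ 'k" and \<pi> where \<pi>: "\<pi> permutes UNIV"
    "\<Sigma> = (\<chi> i j. if i = \<pi> j then 1 else 0)" and J: "sign_matrix J"
    and "transpose (A ** \<Sigma> ** J) ** (A ** \<Sigma> ** J) = transpose B ** B"
    unfolding permutation_matrix_def by metis
  then have "column i B \<bullet> column j B
      = ((J $ i $ i) *\<^sub>R column (\<pi> i) A) \<bullet> ((J $ j $ j) *\<^sub>R column (\<pi> j) A)" for i j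
    unfolding gram_iff column_signed_permutation[OF \<pi>(2) J] by blast
  then show ?equiv
    unfolding signed_gram_equiv_def using \<pi>(1) J
    by (intro exI[of _ \<pi>] exI[of _ "\<lambda>i. J $ i $ i"]) (simp add: sign_matrix_def)
next
  assume ?equiv
  then obtain \<pi> s where \<pi>: "\<pi> permutes UNIV" and s: "\<And>i. s i = 1 \<or> s i = (- 1 :: real)"
    and gram: "\<And>i j. column i B \<bullet> column j B
        = (s i *\<^sub>R column (\<pi> i) A) \<bullet> (s j *\<^sub>R column (\<pi> j) A)"
    unfolding signed_gram_equiv_def by blast
  define \<Sigma> :: "real ^ 'k ^ 'k" where "\<Sigma> = (\<chi> i j. if i = \<pi> j then 1 else 0)"
  define J :: "real ^ 'k ^ 'k" where "J = (\<chi> i j. if i = j then s i else 0)"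
  have J: "sign_matrix J" using s by (simp add: J_def sign_matrix_def)
  have "column j (A ** \<Sigma> ** J) = s j *\<^sub>R column (\<pi> j) A" for j
    using column_signed_permutation[OF \<Sigma>_def J, of j A] by (simp add: J_def)
  then have "transpose (A ** \<Sigma> ** J) ** (A ** \<Sigma> ** J) = transpose B ** B"
    unfolding gram_iff using gram by simp
  moreover have "permutation_matrix \<Sigma>"
    unfolding permutation_matrix_def using \<pi> \<Sigma>_def by blast
  ultimately show ?gram using J by blast
qed

text \<open>Multiplication by a matrix with orthonormal columns preserves inner products; conversely, the
  isometry between families of vectors with equal Gram matrices is given by such a matrix.\<close>

lemma gram_eq_iff_orthonormal_factor:
  fixes A :: "real ^ 'k ^ 'm" and B :: "real ^ 'k ^ 'n"
  assumes "CARD('m) \<le> CARD('n)"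
  shows "transpose A ** A = transpose B ** B \<longleftrightarrow>
    (\<exists>Q :: real ^ 'm ^ 'n. orthonormal_columns Q \<and> B = Q ** A)"
proof
  assume "transpose A ** A = transpose B ** B"
  then have "\<And>i j. column i B \<bullet> column j B = column i A \<bullet> column j A"
    unfolding gram_iff by blast
  moreover have "DIM(real ^ 'm) \<le> DIM(real ^ 'n)" using assms by simp
  ultimately obtain q where q: "linear q" "\<And>x. norm (q x) = norm x"
    "\<And>i. column i B = q (column i A)"
    by (rule isometry_if_gram_eq[of "\<lambda>i. column i B" "\<lambda>i. column i A"]) auto
  have "column i B = column i (matrix q ** A)" for i
    using q(1,3) by (simp add: column_matrix_mult matrix_works)
  then have "B = matrix q ** A" by (simp add: vec_eq_iff column_def)
  moreover have "orthonormal_columns (matrix q)"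
    using q(1,2) by (simp add: orthonormal_columns_iff matrix_works)
  ultimately show "\<exists>Q :: real ^ 'm ^ 'n. orthonormal_columns Q \<and> B = Q ** A" by blast
next
  assume "\<exists>Q :: real ^ 'm ^ 'n. orthonormal_columns Q \<and> B = Q ** A"
  then obtain Q :: "real ^ 'm ^ 'n" where Q: "\<And>x. norm (Q *v x) = norm x" "B = Q ** A"
    by (auto simp: orthonormal_columns_iff)
  have "(Q *v x) \<bullet> (Q *v y) = x \<bullet> y" for x y
    by (simp add: dot_norm matrix_vector_right_distrib[symmetric] Q(1))
  then show "transpose A ** A = transpose B ** B"
    unfolding gram_iff Q(2) column_matrix_mult by simp
qed

text \<open>The isometry carries the signed and permuted columns of \<open>A\<close> to those of \<open>B\<close>, and the zonotope
  of the former is a translate of \<open>zonotope A\<close>.\<close>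

lemma congruent_zonotopes_if_signed_gram_equiv:
  fixes A :: "real ^ 'k ^ 'm" and B :: "real ^ 'k ^ 'n"
  assumes "CARD('m) \<le> CARD('n)"
    and "signed_gram_equiv (\<lambda>i. column i A) (\<lambda>i. column i B)"
  shows "congruent_sets (zonotope A) (zonotope B)"
proof -
  obtain \<pi> s where \<pi>: "\<pi> permutes UNIV" and s: "\<And>i. s i = 1 \<or> s i = (- 1 :: real)"
    and gram: "\<And>i j. column i B \<bullet> column j B
        = (s i *\<^sub>R column (\<pi> i) A) \<bullet> (s j *\<^sub>R column (\<pi> j) A)"
    using assms(2) unfolding signed_gram_equiv_def by blast
  have "DIM(real ^ 'm) \<le> DIM(real ^ 'n)" using assms(1) by simp
  with gram obtain q where q: "linear q" "\<And>x. norm (q x) = norm x"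
    "\<And>i. column i B = q (s i *\<^sub>R column (\<pi> i) A)"
    by (rule isometry_if_gram_eq[of "\<lambda>i. column i B" "\<lambda>i. s i *\<^sub>R column (\<pi> i) A"]) auto
  obtain c where c: "generated_zonotope (\<lambda>j. s j *\<^sub>R column (\<pi> j) A)
      = (\<lambda>x. x + c) ` generated_zonotope (\<lambda>i. column i A)"
    by (rule signed_permutation_translates[where a = "\<lambda>i. column i A", OF \<pi> s])
  let ?f = "\<lambda>x. q (x + c)"
  have "zonotope B = ?f ` zonotope A"
    unfolding zonotope_eq_generated q(3) generated_zonotope_linear_image[OF q(1)] c
    by (simp add: image_image)
  moreover have "dist (?f x) (?f y) = dist x y" for x y
    using q(2)[of "x - y"] by (simp add: dist_norm linear_diff[OF q(1), symmetric])
  ultimately show ?thesis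
    unfolding congruent_sets_def by (intro disjI1 exI[of _ ?f]) auto
qed

text \<open>A distance-preserving map in the reverse direction is covered by the symmetry of
  \<open>signed_gram_equiv\<close>.\<close>

lemma signed_gram_equiv_if_congruent_zonotopes:
  fixes A :: "real ^ 'k ^ 'm" and B :: "real ^ 'k ^ 'n"
  assumes "congruent_sets (zonotope A) (zonotope B)"
    and "no_parallel_columns A" "no_parallel_columns B"
  shows "signed_gram_equiv (\<lambda>i. column i A) (\<lambda>i. column i B)"
  using assms(1) unfolding congruent_sets_def zonotope_eq_generated
proof (elim disjE exE conjE)
  fix f :: "real ^ 'm \<Rightarrow> real ^ 'n"
  assume "\<forall>x y. dist (f x) (f y) = dist x y"
    and "f ` generated_zonotope (\<lambda>i. column i A) = generated_zonotope (\<lambda>i. column i B)"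
  then show ?thesis
    using assms(2,3)
    by (intro signed_gram_equiv_if_isometric[of f]) (auto simp: no_parallel_columns_iff)
next
  fix g :: "real ^ 'n \<Rightarrow> real ^ 'm"
  assume "\<forall>x y. dist (g x) (g y) = dist x y"
    and "g ` generated_zonotope (\<lambda>i. column i B) = generated_zonotope (\<lambda>i. column i A)"
  then show ?thesis
    using assms(2,3)
    by (intro signed_gram_equiv_sym[OF signed_gram_equiv_if_isometric[of g]])
      (auto simp: no_parallel_columns_iff)
qed

theorem theorem2p2:
  fixes A :: "real ^ 'k ^ 'm" and B :: "real ^ 'k ^ 'n"
  assumes "CARD('m) \<le> CARD('n)"
  shows
    "let cong = congruent_sets (zonotope A) (zonotope B);
         gram = (\<exists>(\<Sigma> :: real ^ 'k ^ 'k) (J :: real ^ 'k ^ 'k) A'.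
                   permutation_matrix \<Sigma> \<and> sign_matrix J \<and> A' = A ** \<Sigma> ** J \<and>
                   transpose A' ** A' = transpose B ** B);
         factor = (\<exists>(Q :: real ^ 'm ^ 'n) (\<Sigma> :: real ^ 'k ^ 'k) (J :: real ^ 'k ^ 'k).
                   orthonormal_columns Q \<and> permutation_matrix \<Sigma> \<and> sign_matrix J \<and>
                   B = Q ** A ** \<Sigma> ** J)
     in (gram \<longleftrightarrow> factor) \<and>
        (gram \<longrightarrow> cong) \<and>
        (no_parallel_columns A \<and> no_parallel_columns B \<longrightarrow>
           (cong \<longleftrightarrow> gram) \<and> (cong \<longleftrightarrow> factor))"
proof -
  have factor: "(\<exists>A'. A' = A ** \<Sigma> ** J \<and> transpose A' ** A' = transpose B ** B)
      \<longleftrightarrow> (\<exists>Q :: real ^ 'm ^ 'n. orthonormal_columns Q \<and> B = Q ** A ** \<Sigma> ** J)"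
    for \<Sigma> J :: "real ^ 'k ^ 'k"
    using gram_eq_iff_orthonormal_factor[OF assms, of "A ** \<Sigma> ** J" B]
    by (simp add: matrix_mul_assoc)
  have gram_factor: "(\<exists>(\<Sigma> :: real ^ 'k ^ 'k) (J :: real ^ 'k ^ 'k) A'.
          permutation_matrix \<Sigma> \<and> sign_matrix J \<and> A' = A ** \<Sigma> ** J \<and>
          transpose A' ** A' = transpose B ** B)
      \<longleftrightarrow> (\<exists>(Q :: real ^ 'm ^ 'n) (\<Sigma> :: real ^ 'k ^ 'k) (J :: real ^ 'k ^ 'k).
          orthonormal_columns Q \<and> permutation_matrix \<Sigma> \<and> sign_matrix J \<and>
          B = Q ** A ** \<Sigma> ** J)" (is "?gram \<longleftrightarrow> ?factor")
  proof
    assume ?gram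
    then obtain \<Sigma> J :: "real ^ 'k ^ 'k" where "permutation_matrix \<Sigma>" "sign_matrix J"
      and "\<exists>A'. A' = A ** \<Sigma> ** J \<and> transpose A' ** A' = transpose B ** B" by blast
    then show ?factor unfolding factor by blast
  next
    assume ?factor
    then obtain \<Sigma> J :: "real ^ 'k ^ 'k" where "permutation_matrix \<Sigma>" "sign_matrix J"
      and "\<exists>Q :: real ^ 'm ^ 'n. orthonormal_columns Q \<and> B = Q ** A ** \<Sigma> ** J" by blast
    then show ?gram unfolding factor[symmetric] by blast
  qed
  show ?thesis
    unfolding Let_def gram_factor[symmetric] gram_iff_signed_gram_equiv
    using congruent_zonotopes_if_signed_gram_equiv[OF assms]
      signed_gram_equiv_if_congruent_zonotopes by blast
qed

end
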